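(* Let $\Lambda$ be a finite nonempty set and let $\mathcal{F}=\{f_\lambda:\mathbb{R}\to\mathbb{R} : \lambda\in\Lambda\}$ and $\mathcal{G}=\{g_\lambda:\mathbb{R}\to\mathbb{R} : \lambda\in\Lambda\}$ be two iterated function systems such that for every $\lambda\in\Lambda$ the functions $f_\lambda$ and $g_\lambda$ are homeomorphisms, differentiable at $0$, having the origin as a fixed point. Assume that all the numbers $f_\lambda'(0)$ and $g_\lambda'(0)$, $\lambda\in\Lambda$, belong to the same one of the intervals $(0,1)$, $(-1,0)$, $(1,+\infty)$, $(-\infty,-1)$. Then $\mathcal{F}$ and $\mathcal{G}$ are weakly topologically conjugate on a neighborhood of zero.
   Context: An iterated function system (IFS) on a complete metric space $M$ is a family $\{f_\lambda:M\to M : \lambda\in\Lambda\}$ of continuous maps, with $\Lambda$ a finite nonempty set. For $\sigma=\{\lambda_1,\lambda_2,\ldots\}\in\Lambda^{\mathbb{N}}$ and $n\in\mathbb{N}=\{1,2,\dots\}$ put $F_{\sigma_n}=f_{\lambda_n}\circ f_{\lambda_{n-1}}\circ\cdots\circ f_{\lambda_1}$ and $G_{\sigma_n}=g_{\lambda_n}\circ g_{\lambda_{n-1}}\circ\cdots\circ g_{\lambda_1}$. Two IFSs $\mathcal{F},\mathcal{G}$ on $\mathbb{R}$ with the same index set $\Lambda$ are weakly topologically conjugate on a neighborhood of zero if there is a neighborhood $U$ of $0$ such that for every $\sigma\in\Lambda^{\mathbb{N}}$ and every $n\in\mathbb{N}$ there is a homeomorphism $h$ (possibly depending on $\sigma$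 and $n$) from $U$ onto a neighborhood of $0$ in $\mathbb{R}$ with $h(F_{\sigma_n}(x))=G_{\sigma_n}(h(x))$ for all $x\in U$ with $F_{\sigma_n}(x)\in U$. *)

theory Defs
  imports "HOL-Analysis.Analysis"
begin

definition iterated_function_system ::
    "'i set \<Rightarrow> ('i \<Rightarrow> 'a::complete_space \<Rightarrow> 'a) \<Rightarrow> bool" where
  "iterated_function_system \<Lambda> f \<longleftrightarrow>
     finite \<Lambda> \<and> \<Lambda> \<noteq> {} \<and> (\<forall>l\<in>\<Lambda>. continuous_on UNIV (f l))"

(* Sequences of indices are numbered from 1, so sigma 0 plays no role:
   ifs_comp f sigma n = f (sigma n) o ... o f (sigma 1). *)
primrec ifs_comp :: "('i \<Rightarrow> 'a \<Rightarrow> 'a) \<Rightarrow> (nat \<Rightarrow> 'i) \<Rightarrow> nat \<Rightarrow> 'a \<Rightarrow> 'a" where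
  "ifs_comp f \<sigma> 0 = id"
| "ifs_comp f \<sigma> (Suc n) = f (\<sigma> (Suc n)) \<circ> ifs_comp f \<sigma> n"

(* Neighborhoods of 0 are open sets containing 0. U is uniform in sigma and n,
   whereas h and its image V may depend on both; h 0 = 0 is not demanded. *)
definition weakly_topologically_conjugate_near_0 ::
    "'i set \<Rightarrow> ('i \<Rightarrow> real \<Rightarrow> real) \<Rightarrow> ('i \<Rightarrow> real \<Rightarrow> real) \<Rightarrow> bool" where
  "weakly_topologically_conjugate_near_0 \<Lambda> f g \<longleftrightarrow>
     (\<exists>U. open U \<and> 0 \<in> U \<and>
       (\<forall>\<sigma> \<in> {1..} \<rightarrow> \<Lambda>. \<forall>n\<ge>1.
         \<exists>V h h'. open V \<and> 0 \<in> V \<and> homeomorphism U V h h' \<and>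
           (\<forall>x\<in>U. ifs_comp f \<sigma> n x \<in> U \<longrightarrow>
              h (ifs_comp f \<sigma> n x) = ifs_comp g \<sigma> n (h x))))"

end

theory Submission
  imports Defs
begin

text \<open>
  If all derivatives have modulus less than 1, there is a d such that every f l and g l, hence every
  composition F or G, decreases the modulus on the interval [-d, d]. When F is increasing, each
  point of (0, d] lies in exactly one of the intervals (F^(n+1) d, F^n d]; sweeping through them
  affinely in the first one gives a decreasing bijection p from [0, \<infinity>) onto (0, d] with
  p (t + 1) = F (p t), and matching the parametrisations of F and G gives the conjugacy on the right
  of 0. When F and G are decreasing, a conjugacy h of F o F and G o G on the right of 0 is continued
  by G^(-1) o h o F on the left. If the moduli exceed 1, the same applies to the inverse maps.
\<close>

section \<open>Increasing bijections of the real line\<close>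

text \<open>A monotone map with open image has no jumps, hence is continuous, and the inverse is
  again increasing and onto. So every conjugacy below only has to be shown increasing and
  surjective.\<close>

lemma strict_mono_surj_homeomorphism:
  fixes h :: "real \<Rightarrow> real"
  assumes "strict_mono h" "surj h"
  shows "homeomorphism UNIV UNIV h (inv h)"
proof -
  have inv: "\<And>x. inv h (h x) = x" "\<And>y. h (inv h y) = y"
    using assms by (simp_all add: strict_mono_imp_inj_on surj_f_inv_f)
  have "strict_mono (inv h)"
    using assms inv(1) by (rule strict_mono_inv)
  moreover have "surj (inv h)"
    using inv(1) by (metis surjI)
  ultimately have "continuous_on UNIV h" "continuous_on UNIV (inv h)"
    using assms by (auto intro!: continuous_onI_mono simp: strict_mono_less_eq)
  then show ?thesis
    using inv \<open>surj (inv h)\<close> assms(2) by (simp add: homeomorphism_def)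
qed

section \<open>Orbit parametrisation of a one-sided contraction\<close>

text \<open>The floor counts iterations; the fractional part is the position in the fundamental
  domain \<open>(F d, d]\<close>, swept downwards from \<open>d\<close>. The inverse solves Abel's
  equation for \<open>F\<close> on \<open>(0, d]\<close>. As \<open>nat\<close> sends negative
  floors to 0, only \<open>0 \<le> t\<close> is meaningful.\<close>

definition orbit_param :: "(real \<Rightarrow> real) \<Rightarrow> real \<Rightarrow> real \<Rightarrow> real" where
  "orbit_param F d t = (F ^^ nat \<lfloor>t\<rfloor>) (d - frac t * (d - F d))"

text \<open>The dynamics is one-sided; the left half line is reached later by reflection. Being a
  bijection of the whole line, \<open>F\<close> is continuous and its iterates have preimages
  everywhere.\<close>

locale right_contraction =
  fixes F :: "real \<Rightarrow> real" and d :: real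
  assumes smono: "strict_mono F" and surj: "surj F" and zero: "F 0 = 0"
    and d_pos: "0 < d" and contr: "\<And>x. 0 < x \<Longrightarrow> x \<le> d \<Longrightarrow> F x < x"
begin

lemma pos: "0 < x \<Longrightarrow> 0 < F x"
  using strict_monoD[OF smono, of 0 x] zero by simp

lemma funpow_strict_mono: "strict_mono (F ^^ n)"
  using smono by (induction n) (auto simp: strict_mono_def)

lemma orbit_bounds: "0 < (F ^^ n) d \<and> (F ^^ n) d \<le> d"
proof (induction n)
  case (Suc n)
  then show ?case
    using pos[of "(F ^^ n) d"] contr[of "(F ^^ n) d"] by simp
qed (simp add: d_pos)

lemma orbit_decseq: "decseq (\<lambda>n. (F ^^ n) d)"
  using orbit_bounds contr by (intro decseq_SucI) (auto simp: less_imp_le)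

text \<open>The orbit decreases and is bounded below, so it converges; by continuity the limit is a
  fixed point in \<open>[0, d]\<close>, and \<open>contr\<close> leaves only 0.\<close>

lemma orbit_tendsto_0: "(\<lambda>n. (F ^^ n) d) \<longlonglongrightarrow> 0"
proof -
  obtain L where L: "(\<lambda>n. (F ^^ n) d) \<longlonglongrightarrow> L" and "\<forall>n. L \<le> (F ^^ n) d"
    using decseq_convergent[OF orbit_decseq, of 0] orbit_bounds less_imp_le by metis
  then have "L \<le> d"
    by (metis funpow_0)
  have "0 \<le> L"
    using LIMSEQ_le_const[OF L, of 0] orbit_bounds less_imp_le by blast
  have "isCont F L"
    using strict_mono_surj_homeomorphism[OF smono surj]
    by (simp add: homeomorphism_def continuous_on_eq_continuous_at)
  then have "(\<lambda>n. F ((F ^^ n) d)) \<longlonglongrightarrow> F L"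
    using L by (rule isCont_tendsto_compose)
  moreover have "(\<lambda>n. F ((F ^^ n) d)) \<longlonglongrightarrow> L"
    using LIMSEQ_Suc[OF L] by simp
  ultimately have "F L = L"
    by (rule LIMSEQ_unique)
  then have "L = 0"
    using contr[of L] \<open>0 \<le> L\<close> \<open>L \<le> d\<close> by force
  with L show ?thesis by simp
qed

text \<open>Since \<open>frac t\<close> lies in \<open>[0, 1)\<close>, the affine argument lies in
  \<open>(F d, d]\<close>, and the increasing iterate carries this interval along the orbit.\<close>

lemma orbit_param_bounds:
  "(F ^^ Suc (nat \<lfloor>t\<rfloor>)) d < orbit_param F d t" "orbit_param F d t \<le> (F ^^ nat \<lfloor>t\<rfloor>) d"
proof -
  have "0 < d - F d"
    using contr[of d] d_pos by simp
  then have "frac t * (d - F d) < d - F d" "0 \<le> frac t * (d - F d)"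
    using frac_lt_1[of t] by (simp_all add: frac_ge_0)
  then have "F d < d - frac t * (d - F d)" "d - frac t * (d - F d) \<le> d"
    by linarith+
  then show "(F ^^ Suc (nat \<lfloor>t\<rfloor>)) d < orbit_param F d t" "orbit_param F d t \<le> (F ^^ nat \<lfloor>t\<rfloor>) d"
    unfolding orbit_param_def funpow_Suc_right
    using funpow_strict_mono by (auto simp: strict_mono_less strict_mono_less_eq)
qed

lemma orbit_param_in: "orbit_param F d t \<in> {0<..d}"
  using orbit_param_bounds[of t] orbit_bounds[of "nat \<lfloor>t\<rfloor>"] orbit_bounds[of "Suc (nat \<lfloor>t\<rfloor>)"]
  by auto

text \<open>For equal floors the affine sweep goes down; for different floors the values lie in
  disjoint orbit intervals, the later one being lower.\<close>

lemma orbit_param_antimono: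
  assumes "0 \<le> s" "s < t"
  shows "orbit_param F d t < orbit_param F d s"
proof (cases "\<lfloor>s\<rfloor> = \<lfloor>t\<rfloor>")
  case True
  then have "frac s < frac t"
    using assms by (simp add: frac_def)
  moreover have "F d < d"
    using contr[of d] d_pos by simp
  ultimately have "frac s * (d - F d) < frac t * (d - F d)"
    by simp
  with True show ?thesis
    using strict_mono_less[OF funpow_strict_mono] by (simp add: orbit_param_def)
next
  case False
  then have "\<lfloor>s\<rfloor> < \<lfloor>t\<rfloor>"
    using floor_mono[of s t] assms by linarith
  then have "Suc (nat \<lfloor>s\<rfloor>) \<le> nat \<lfloor>t\<rfloor>"
    using assms by linarith
  then have "(F ^^ nat \<lfloor>t\<rfloor>) d \<le> (F ^^ Suc (nat \<lfloor>s\<rfloor>)) d"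
    by (rule decseqD[OF orbit_decseq])
  then show ?thesis
    using orbit_param_bounds(1)[of s] orbit_param_bounds(2)[of t] by linarith
qed

text \<open>Adding 1 keeps the fractional part and adds one iteration: in the coordinate
  \<open>t\<close> the map is a translation.\<close>

lemma orbit_param_Suc: "0 \<le> t \<Longrightarrow> orbit_param F d (t + 1) = F (orbit_param F d t)"
  by (simp add: orbit_param_def frac_def nat_add_distrib)

lemma orbit_param_onto:
  assumes "0 < x" "x \<le> d"
  shows "\<exists>t\<ge>0. orbit_param F d t = x"
proof -
  have "\<exists>n. (F ^^ n) d < x"
    using order_tendstoD(2)[OF orbit_tendsto_0 assms(1)] eventually_happens sequentially_bot by blast
  \<comment> \<open>The least such index is positive because \<open>x \<le> d\<close>; its
    predecessor names the orbit interval containing \<open>x\<close>.\<close>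
  then obtain m where "(F ^^ m) d < x" and least: "\<And>k. k < m \<Longrightarrow> \<not> (F ^^ k) d < x"
    using exists_least_iff[of "\<lambda>n. (F ^^ n) d < x"] by auto
  then obtain n where "m = Suc n"
    using assms by (cases m) auto
  then have n: "(F ^^ Suc n) d < x" "x \<le> (F ^^ n) d"
    using \<open>(F ^^ m) d < x\<close> least[of n] by auto
  have "surj (F ^^ n)"
    by (rule surj_fn[OF surj])
  then obtain y where y: "(F ^^ n) y = x"
    by (metis surjD)
  then have "F d < y" "y \<le> d"
    using n funpow_strict_mono[of n]
    by (auto simp: funpow_Suc_right strict_mono_less strict_mono_less_eq simp del: funpow.simps)
  \<comment> \<open>Solves \<open>d - u * (d - F d) = y\<close>; the bounds on \<open>y\<close> put
    \<open>u\<close> in \<open>[0, 1)\<close>, so \<open>u\<close> can serve as a fractional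
    part.\<close>
  define u where "u = (d - y) / (d - F d)"
  have "0 \<le> u" "u < 1" "u * (d - F d) = d - y"
    using \<open>F d < y\<close> \<open>y \<le> d\<close> by (auto simp: u_def)
  then have "\<lfloor>u\<rfloor> = 0"
    by (simp add: floor_eq_iff)
  then have "nat \<lfloor>real n + u\<rfloor> = n" "frac (real n + u) = u"
    by (simp_all add: frac_def)
  then have "orbit_param F d (real n + u) = x"
    using y \<open>u * (d - F d) = d - y\<close> by (simp add: orbit_param_def)
  then show ?thesis
    using \<open>0 \<le> u\<close> by (intro exI[of _ "real n + u"]) auto
qed

text \<open>Inverse of the parametrisation on \<open>(0, d]\<close>, where
  \<open>orbit_param_onto\<close> gives existence and \<open>orbit_param_antimono\<close>
  uniqueness; the value elsewhere is arbitrary.\<close>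

definition time :: "real \<Rightarrow> real" where
  "time x = (SOME t. 0 \<le> t \<and> orbit_param F d t = x)"

lemma time:
  assumes "0 < x" "x \<le> d"
  shows "0 \<le> time x" "orbit_param F d (time x) = x"
  using someI_ex[of "\<lambda>t. 0 \<le> t \<and> orbit_param F d t = x"] orbit_param_onto[OF assms]
  by (auto simp: time_def)

lemma time_orbit_param:
  assumes "0 \<le> t"
  shows "time (orbit_param F d t) = t"
  using time[of "orbit_param F d t"] orbit_param_in[of t] orbit_param_antimono assms
  by (metis greaterThanAtMost_iff less_irrefl linorder_neqE_linordered_idom)

end

section \<open>Conjugacies of contractions and expansions\<close>

text \<open>Points with equal times correspond. Both maps raise the time by 1, so the correspondence
  intertwines them.\<close>

lemma half_line_conjugacy:
  assumes "right_contraction F d" "right_contraction G d"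
  obtains h where "strict_mono h" "surj h" "h 0 = 0"
    "\<And>x. 0 \<le> x \<Longrightarrow> x \<le> d \<Longrightarrow> h (F x) = G (h x)"
proof -
  interpret F: right_contraction F d by fact
  interpret G: right_contraction G d by fact
  \<comment> \<open>The identity outside \<open>(0, d]\<close> makes \<open>h\<close> a monotone bijection of the line, so that
    continuity comes for free.\<close>
  define h where "h x = (if 0 < x \<and> x \<le> d then orbit_param G d (F.time x) else x)" for x
  have h_in: "0 < h x" "h x \<le> d" if "0 < x" "x \<le> d" for x
    using G.orbit_param_in[of "F.time x"] that by (auto simp: h_def)
  have h_param: "h (orbit_param F d t) = orbit_param G d t" if "0 \<le> t" for t
    using F.orbit_param_in[of t] that by (simp add: h_def F.time_orbit_param)
  have "h x < h y" if "x < y" for x y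
  proof -
    \<comment> \<open>Because \<open>h\<close> keeps \<open>(0, d]\<close> inside itself and is the
      identity elsewhere, only two points of \<open>(0, d]\<close> need their times compared; there
      two order-reversing parametrisations are composed.\<close>
    consider "x \<le> 0" | "0 < x" "d < y" | "0 < x" "y \<le> d"
      by linarith
    then show ?thesis
    proof cases
      case 3
      have "F.time y < F.time x"
      proof (rule ccontr)
        assume "\<not> F.time y < F.time x"
        then have "F.time x = F.time y \<or> F.time x < F.time y" by linarith
        then have "y \<le> x"
          using F.orbit_param_antimono[of "F.time x" "F.time y"] F.time[of x] F.time[of y] 3 that
          by auto
        with that show False by simp
      qed
      then show ?thesis
        using 3 that F.time[of y] G.orbit_param_antimono by (simp add: h_def)
    next
      case 1
      then show ?thesis
        using that h_in[of y] by (cases "0 < y \<and> y \<le> d") (auto simp: h_def)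
    next
      case 2
      then show ?thesis
        using that h_in[of x] by (cases "x \<le> d") (auto simp: h_def)
    qed
  qed
  then have "strict_mono h"
    by (rule strict_monoI)
  moreover have "surj h"
  proof (rule surjI)
    fix y
    \<comment> \<open>The right inverse is the same construction with \<open>F\<close> and
      \<open>G\<close> exchanged.\<close>
    show "h (if 0 < y \<and> y \<le> d then orbit_param F d (G.time y) else y) = y"
      using G.time[of y] h_param[of "G.time y"]
      by (cases "0 < y \<and> y \<le> d") (simp, auto simp: h_def)
  qed
  moreover have h0: "h 0 = 0"
    by (simp add: h_def)
  moreover have "h (F x) = G (h x)" if x: "0 \<le> x" "x \<le> d" for x
  proof (cases "x = 0")
    case True
    then show ?thesis using h0 F.zero G.zero by simp
  next
    case False
    then have t: "0 \<le> F.time x" "orbit_param F d (F.time x) = x"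
      using x F.time by auto
    then have "h (F x) = h (orbit_param F d (F.time x + 1))"
      using F.orbit_param_Suc by simp
    also have "\<dots> = orbit_param G d (F.time x + 1)"
      using t by (intro h_param) simp
    also have "\<dots> = G (h x)"
      using t G.orbit_param_Suc h_param by metis
    finally show ?thesis .
  qed
  ultimately show thesis ..
qed

text \<open>Increasing maps fixing 0 preserve signs, so the two branches do not overlap and each
  covers its own half line.\<close>

lemma glue_at_0:
  fixes h k :: "real \<Rightarrow> real"
  assumes "strict_mono h" "surj h" "h 0 = 0" "strict_mono k" "surj k" "k 0 = 0"
  defines "e \<equiv> \<lambda>x. if 0 \<le> x then h x else k x"
  shows "strict_mono e" "surj e"
proof -
  have sgn: "0 \<le> h x \<longleftrightarrow> 0 \<le> x" "0 \<le> k x \<longleftrightarrow> 0 \<le> x" for x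
    using assms strict_mono_less_eq[of h 0 x] strict_mono_less_eq[of k 0 x] by auto
  show "strict_mono e"
  proof (rule strict_monoI)
    fix x y :: real
    assume "x < y"
    then show "e x < e y"
      using sgn[of x] sgn[of y] strict_monoD[OF assms(1) \<open>x < y\<close>] strict_monoD[OF assms(4) \<open>x < y\<close>]
      by (auto simp: e_def)
  qed
  show "surj e"
  proof (rule surjI)
    fix y
    show "e (if 0 \<le> y then inv h y else inv k y) = y"
      using sgn[of "inv h y"] sgn[of "inv k y"] assms(2,5) by (auto simp: e_def surj_f_inv_f)
  qed
qed

lemma strict_antimono_inv:
  fixes f g :: "real \<Rightarrow> real"
  assumes "strict_antimono_on UNIV f" "surj f" "\<And>x. g (f x) = x"
  shows "strict_antimono_on UNIV g"
proof (rule monotone_onI)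
  fix x y :: real
  assume "x < y"
  obtain a b where "x = f a" "y = f b"
    using assms(2) by (metis surjD)
  with \<open>x < y\<close> have "\<not> a < b" "a \<noteq> b"
    using monotone_onD[OF assms(1), of a b] by auto
  then show "g y < g x"
    using assms(3) \<open>x = f a\<close> \<open>y = f b\<close> by simp
qed

text \<open>With decreasing maps the direction of a composition depends on the parity of its length;
  what survives composition is that the two systems agree.\<close>

definition same_direction :: "(real \<Rightarrow> real) \<Rightarrow> (real \<Rightarrow> real) \<Rightarrow> bool" where
  "same_direction F G \<longleftrightarrow>
     strict_mono F \<and> strict_mono G \<or> strict_antimono_on UNIV F \<and> strict_antimono_on UNIV G"

lemma contraction_conjugacy:
  assumes dir: "same_direction F G"
    and F: "surj F" "F 0 = 0" "\<And>x. x \<noteq> 0 \<Longrightarrow> \<bar>x\<bar> \<le> d \<Longrightarrow> \<bar>F x\<bar> < \<bar>x\<bar>"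
    and G: "surj G" "G 0 = 0" "\<And>x. x \<noteq> 0 \<Longrightarrow> \<bar>x\<bar> \<le> d \<Longrightarrow> \<bar>G x\<bar> < \<bar>x\<bar>"
    and "0 < d"
  obtains h where "strict_mono h" "surj h" "h 0 = 0" "\<And>x. \<bar>x\<bar> \<le> d \<Longrightarrow> h (F x) = G (h x)"
  using dir unfolding same_direction_def
proof (elim disjE conjE)
  assume mono: "strict_mono F" "strict_mono G"
  have right: "right_contraction H d"
    if "strict_mono H" "surj H" "H 0 = 0" "\<And>x. x \<noteq> 0 \<Longrightarrow> \<bar>x\<bar> \<le> d \<Longrightarrow> \<bar>H x\<bar> < \<bar>x\<bar>" for H
  proof
    show "H x < x" if "0 < x" "x \<le> d" for x
      using \<open>x \<noteq> 0 \<Longrightarrow> \<bar>x\<bar> \<le> d \<Longrightarrow> \<bar>H x\<bar> < \<bar>x\<bar>\<close> that by linarith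
  qed (use that \<open>0 < d\<close> in auto)
  \<comment> \<open>Conjugation by \<open>x \<mapsto> - x\<close> moves the left half line to the
    right one and keeps the map increasing.\<close>
  have left: "right_contraction (\<lambda>x. - H (- x)) d"
    if H: "strict_mono H" "surj H" "H 0 = 0" "\<And>x. x \<noteq> 0 \<Longrightarrow> \<bar>x\<bar> \<le> d \<Longrightarrow> \<bar>H x\<bar> < \<bar>x\<bar>" for H
  proof (rule right)
    show "strict_mono (\<lambda>x. - H (- x))"
      using H(1) by (auto simp: strict_mono_def)
    show "surj (\<lambda>x. - H (- x))"
      using surj_f_inv_f[OF H(2)] by (intro surjI[of _ "\<lambda>y. - inv H (- y)"]) simp
  qed (use H(3) H(4)[of "- x" for x] in auto)
  obtain h where h: "strict_mono h" "surj h" "h 0 = 0"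
      "\<And>x. 0 \<le> x \<Longrightarrow> x \<le> d \<Longrightarrow> h (F x) = G (h x)"
    using half_line_conjugacy[OF right[OF mono(1) F] right[OF mono(2) G]] by metis
  obtain k where k: "strict_mono k" "surj k" "k 0 = 0"
      "\<And>x. 0 \<le> x \<Longrightarrow> x \<le> d \<Longrightarrow> k (- F (- x)) = - G (- k x)"
    using half_line_conjugacy[OF left[OF mono(1) F] left[OF mono(2) G]] by metis
  define k' where "k' x = - k (- x)" for x
  define e where "e = (\<lambda>x. if 0 \<le> x then h x else k' x)"
  have k': "strict_mono k'" "surj k'" "k' 0 = 0"
    using k(1,3) surj_f_inv_f[OF k(2)]
    by (auto simp: k'_def strict_mono_def intro!: surjI[of _ "\<lambda>y. - inv k (- y)"])
  show thesis
  proof (rule that)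
    show "strict_mono e" "surj e"
      unfolding e_def by (rule glue_at_0[OF h(1-3) k'])+
    show "e 0 = 0"
      by (simp add: e_def h(3))
    fix x :: real
    assume "\<bar>x\<bar> \<le> d"
    \<comment> \<open>An increasing \<open>F\<close> fixing 0 preserves signs, so \<open>x\<close>
      and \<open>F x\<close> fall under the same branch of \<open>e\<close>.\<close>
    have "0 \<le> F x \<longleftrightarrow> 0 \<le> x"
      using strict_mono_less_eq[OF mono(1), of 0 x] F(2) by simp
    then show "e (F x) = G (e x)"
      using h(4)[of x] k(4)[of "- x"] \<open>\<bar>x\<bar> \<le> d\<close> by (auto simp: e_def k'_def)
  qed
next
  assume anti: "strict_antimono_on UNIV F" "strict_antimono_on UNIV G"
  have less: "F y < F x \<longleftrightarrow> x < y" "G y < G x \<longleftrightarrow> x < y" for x y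
    using monotone_onD[OF anti(1)] monotone_onD[OF anti(2)]
    by (metis UNIV_I linorder_neqE_linordered_idom less_asym less_irrefl)+
  have square: "right_contraction (\<lambda>x. H (H x)) d"
    if "strict_antimono_on UNIV H" "surj H" "H 0 = 0" "\<And>x. x \<noteq> 0 \<Longrightarrow> \<bar>x\<bar> \<le> d \<Longrightarrow> \<bar>H x\<bar> < \<bar>x\<bar>" for H
  proof
    show "strict_mono (\<lambda>x. H (H x))"
      using that(1) by (auto simp: monotone_on_def)
    show "surj (\<lambda>x. H (H x))"
      using comp_surj[OF that(2) that(2)] by (simp add: comp_def)
    fix x :: real
    assume x: "0 < x" "x \<le> d"
    \<comment> \<open>In particular \<open>H x \<noteq> 0\<close>, so the modulus bound applies a
      second time, at \<open>H x\<close>.\<close>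
    have "H x < 0"
      using monotone_onD[OF that(1), of 0 x] x that(3) by simp
    then show "H (H x) < x"
      using that(4)[of x] that(4)[of "H x"] x by force
  qed (use that \<open>0 < d\<close> in auto)
  obtain h where h: "strict_mono h" "surj h" "h 0 = 0"
      "\<And>x. 0 \<le> x \<Longrightarrow> x \<le> d \<Longrightarrow> h (F (F x)) = G (G (h x))"
    using half_line_conjugacy[OF square[OF anti(1) F] square[OF anti(2) G]] by metis
  have "inj G"
    by (rule injI) (metis less(2) linorder_neqE_linordered_idom less_irrefl)
  then have invG: "\<And>y. G (inv G y) = y" "\<And>x. inv G (G x) = x"
    using G(1) by (simp_all add: surj_f_inv_f)
  \<comment> \<open>Forced by the equation at negative \<open>x\<close>: there \<open>F x\<close> is
    positive and \<open>h (F x) = G (k x)\<close> must hold. The reversals by \<open>F\<close> and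
    \<open>inv G\<close> cancel, so \<open>k\<close> is increasing.\<close>
  define k where "k x = inv G (h (F x))" for x
  have k: "strict_mono k" "surj k" "k 0 = 0"
  proof -
    show "strict_mono k"
    proof (rule strict_monoI)
      fix x y :: real
      assume "x < y"
      then have "G (k y) < G (k x)"
        using less(1) h(1) by (simp add: k_def invG strict_mono_less)
      then show "k x < k y"
        using less(2) by simp
    qed
    show "surj k"
    proof (rule surjI)
      fix y
      show "k (inv F (inv h (G y))) = y"
        by (simp add: k_def surj_f_inv_f F(1) h(2) invG)
    qed
    show "k 0 = 0"
      using F(2) h(3) invG(2)[of 0] G(2) by (simp add: k_def)
  qed
  define e where "e = (\<lambda>x. if 0 \<le> x then h x else k x)"
  show thesis
  proof (rule that)
    show "strict_mono e" "surj e"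
      unfolding e_def by (rule glue_at_0[OF h(1-3) k])+
    show "e 0 = 0"
      by (simp add: e_def h(3))
    fix x :: real
    assume x: "\<bar>x\<bar> \<le> d"
    consider "x = 0" | "0 < x" | "x < 0" by linarith
    then show "e (F x) = G (e x)"
    proof cases
      case 1
      then show ?thesis using F(2) G(2) h(3) by (simp add: e_def)
    next
      case 2
      \<comment> \<open>Now \<open>e (F x)\<close> is \<open>inv G (h (F (F x)))\<close>, and the
        relation between the squares reduces it to \<open>G (h x)\<close>.\<close>
      then have "F x < 0" using less(1)[of x 0] F(2) by simp
      then show ?thesis using 2 x h(4)[of x] by (simp add: e_def k_def invG)
    next
      case 3
      then have "0 < F x" using less(1)[of 0 x] F(2) by simp
      then show ?thesis using 3 by (simp add: e_def k_def invG)
    qed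
  qed
qed

text \<open>A conjugacy of the inverse maps also conjugates the maps themselves. Smallness is
  imposed on the values \<open>F x\<close> and \<open>G x\<close>, so that substituting
  \<open>x = inv F y\<close> or \<open>x = inv G y\<close> gives a contraction on
  \<open>[-d, d]\<close>.\<close>

lemma expansion_conjugacy:
  assumes dir: "same_direction F G"
    and F: "surj F" "F 0 = 0" "\<And>x. x \<noteq> 0 \<Longrightarrow> \<bar>F x\<bar> \<le> d \<Longrightarrow> \<bar>x\<bar> < \<bar>F x\<bar>"
    and G: "surj G" "G 0 = 0" "\<And>x. x \<noteq> 0 \<Longrightarrow> \<bar>G x\<bar> \<le> d \<Longrightarrow> \<bar>x\<bar> < \<bar>G x\<bar>"
    and "0 < d"
  obtains h where "strict_mono h" "surj h" "h 0 = 0" "\<And>x. \<bar>F x\<bar> \<le> d \<Longrightarrow> h (F x) = G (h x)"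
proof -
  have "inj F" "inj G"
    using dir by (auto simp: same_direction_def monotone_on_def inj_def)
       (metis linorder_neqE_linordered_idom less_irrefl)+
  then have inv: "F (inv F y) = y" "G (inv G y) = y" "inv F (F x) = x" "inv G (G x) = x" for x y
    using F(1) G(1) by (simp_all add: surj_f_inv_f)
  have "same_direction (inv F) (inv G)"
    using dir unfolding same_direction_def
  proof (elim disj_forward conj_forward)
    show "strict_mono (inv F)" if "strict_mono F"
      using strict_mono_inv[OF that F(1)] inv by simp
    show "strict_mono (inv G)" if "strict_mono G"
      using strict_mono_inv[OF that G(1)] inv by simp
    show "strict_antimono_on UNIV (inv F)" if "strict_antimono_on UNIV F"
      using strict_antimono_inv[OF that F(1)] inv by simp
    show "strict_antimono_on UNIV (inv G)" if "strict_antimono_on UNIV G"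
      using strict_antimono_inv[OF that G(1)] inv by simp
  qed
  moreover have "surj (inv F)" "surj (inv G)"
    using inv by (metis surjI)+
  moreover have inv0: "inv F 0 = 0" "inv G 0 = 0"
    using inv F(2) G(2) by metis+
  moreover have "\<bar>inv F y\<bar> < \<bar>y\<bar>" "\<bar>inv G y\<bar> < \<bar>y\<bar>" if "y \<noteq> 0" "\<bar>y\<bar> \<le> d" for y
    using F(3)[of "inv F y"] G(3)[of "inv G y"] that inv F(2) G(2) by metis+
  ultimately obtain h where h: "strict_mono h" "surj h" "h 0 = 0"
      "\<And>y. \<bar>y\<bar> \<le> d \<Longrightarrow> h (inv F y) = inv G (h y)"
    using contraction_conjugacy[of "inv F" "inv G" d] \<open>0 < d\<close> by metis
  show thesis
    \<comment> \<open>Take \<open>y = F x\<close> in the relation for the inverses and apply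
      \<open>G\<close>.\<close>
    using h inv by (intro that[of h]) metis+
qed

section \<open>Compositions along an index sequence\<close>

lemma ifs_comp_fixed:
  assumes "\<And>l. l \<in> \<Lambda> \<Longrightarrow> f l z = z" "\<sigma> \<in> {1..} \<rightarrow> \<Lambda>"
  shows "ifs_comp f \<sigma> n z = z"
  using assms by (induction n) auto

lemma surj_ifs_comp:
  assumes "\<And>l. l \<in> \<Lambda> \<Longrightarrow> surj (f l)" "\<sigma> \<in> {1..} \<rightarrow> \<Lambda>"
  shows "surj (ifs_comp f \<sigma> n)"
proof (induction n)
  case (Suc n)
  have "surj (f (\<sigma> (Suc n)))"
    using assms by (simp add: Pi_iff)
  with Suc show ?case
    by (simp only: ifs_comp.simps comp_surj)
qed simp

lemma same_direction_ifs_comp: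
  assumes "(\<forall>l\<in>\<Lambda>. strict_mono (f l) \<and> strict_mono (g l)) \<or>
      (\<forall>l\<in>\<Lambda>. strict_antimono_on UNIV (f l) \<and> strict_antimono_on UNIV (g l))"
    and "\<sigma> \<in> {1..} \<rightarrow> \<Lambda>"
  shows "same_direction (ifs_comp f \<sigma> n) (ifs_comp g \<sigma> n)"
proof (induction n)
  case 0
  show ?case by (simp add: same_direction_def monotone_on_def)
next
  case (Suc n)
  have "\<sigma> (Suc n) \<in> \<Lambda>" using assms(2) by auto
  then have "same_direction (f (\<sigma> (Suc n))) (g (\<sigma> (Suc n)))"
    using assms(1) by (auto simp: same_direction_def)
  with Suc show ?case
    by (auto simp: same_direction_def monotone_on_def)
qed

text \<open>The first map gives strictness. The later ones satisfy the weak inequality, valid also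
  at 0, and the orbit never leaves \<open>[-d, d]\<close>; hence one \<open>d\<close> serves all
  \<open>n\<close>.\<close>

lemma ifs_comp_contraction:
  fixes f :: "'i \<Rightarrow> real \<Rightarrow> real"
  assumes "\<And>l x. l \<in> \<Lambda> \<Longrightarrow> x \<noteq> 0 \<Longrightarrow> \<bar>x\<bar> \<le> d \<Longrightarrow> \<bar>f l x\<bar> < \<bar>x\<bar>"
    and "\<And>l. l \<in> \<Lambda> \<Longrightarrow> f l 0 = 0" "\<sigma> \<in> {1..} \<rightarrow> \<Lambda>" "1 \<le> n" "x \<noteq> 0" "\<bar>x\<bar> \<le> d"
  shows "\<bar>ifs_comp f \<sigma> n x\<bar> < \<bar>x\<bar>"
  using assms(4)
proof (induction n rule: dec_induct)
  case base
  have "\<sigma> 1 \<in> \<Lambda>" using assms(3) by auto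
  then show ?case using assms(1,5,6) by simp
next
  case (step n)
  have "\<sigma> (Suc n) \<in> \<Lambda>" using assms(3) by auto
  then have "\<bar>f (\<sigma> (Suc n)) y\<bar> \<le> \<bar>y\<bar>" if "\<bar>y\<bar> \<le> d" for y
    using assms(1)[of _ y] assms(2) that by (cases "y = 0") (auto simp: less_imp_le)
  from this[of "ifs_comp f \<sigma> n x"] show ?case
    using step.IH assms(6) by simp
qed

text \<open>Here the bound is on the final value and passes backwards: the last map does not
  decrease the modulus, so the preceding value is within \<open>d\<close> too and the induction
  hypothesis applies.\<close>

lemma ifs_comp_expansion:
  fixes f :: "'i \<Rightarrow> real \<Rightarrow> real"
  assumes "\<And>l x. l \<in> \<Lambda> \<Longrightarrow> x \<noteq> 0 \<Longrightarrow> \<bar>f l x\<bar> \<le> d \<Longrightarrow> \<bar>x\<bar> < \<bar>f l x\<bar>"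
    and "\<And>l. l \<in> \<Lambda> \<Longrightarrow> f l 0 = 0" "\<sigma> \<in> {1..} \<rightarrow> \<Lambda>" "1 \<le> n" "x \<noteq> 0"
    and "\<bar>ifs_comp f \<sigma> n x\<bar> \<le> d"
  shows "\<bar>x\<bar> < \<bar>ifs_comp f \<sigma> n x\<bar>"
  using assms(4,6)
proof (induction n rule: dec_induct)
  case base
  have "\<sigma> 1 \<in> \<Lambda>" using assms(3) by auto
  then show ?case using assms(1,5) base by simp
next
  case (step n)
  have "\<sigma> (Suc n) \<in> \<Lambda>" using assms(3) by auto
  then have "\<bar>y\<bar> \<le> \<bar>f (\<sigma> (Suc n)) y\<bar>" if "\<bar>f (\<sigma> (Suc n)) y\<bar> \<le> d" for y
    using assms(1)[of _ y] assms(2) that by (cases "y = 0") (auto simp: less_imp_le)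
  from this[of "ifs_comp f \<sigma> n x"] show ?case
    using step.IH step.prems by simp
qed

section \<open>Local information from the derivative at 0\<close>

lemma homeomorphism_monotone:
  fixes f :: "real \<Rightarrow> real"
  assumes "homeomorphism UNIV UNIV f f'"
  shows "strict_mono f \<or> strict_antimono_on UNIV f"
proof -
  have "continuous_map euclidean euclideanreal f" "inj f"
    using assms by (auto simp: homeomorphism_def inj_def) metis
  then show ?thesis
    using injective_eq_monotone_map[of UNIV f] assms by (simp add: homeomorphism_def)
qed

text \<open>A homeomorphism of the line is globally increasing or decreasing, so the single
  comparison of \<open>f 0\<close> with \<open>f (e / 2)\<close> supplied by the derivative decides
  which.\<close>

lemma strict_mono_of_deriv_pos:
  fixes f :: "real \<Rightarrow> real"
  assumes "homeomorphism UNIV UNIV f f'" "(f has_real_derivative D) (at 0)" "0 < D"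
  shows "strict_mono f"
proof -
  obtain e where "0 < e" "\<And>h. 0 < h \<Longrightarrow> h < e \<Longrightarrow> f 0 < f (0 + h)"
    using DERIV_pos_inc_right[OF assms(2,3)] by blast
  from this(2)[of "e / 2"] have "f 0 < f (e / 2)" "0 < e / 2"
    using \<open>0 < e\<close> by auto
  then show ?thesis
    using homeomorphism_monotone[OF assms(1)] monotone_onD[of UNIV "(<)" "(>)" f 0 "e / 2"]
    by auto
qed

lemma strict_antimono_of_deriv_neg:
  fixes f :: "real \<Rightarrow> real"
  assumes "homeomorphism UNIV UNIV f f'" "(f has_real_derivative D) (at 0)" "D < 0"
  shows "strict_antimono_on UNIV f"
proof -
  obtain e where "0 < e" "\<And>h. 0 < h \<Longrightarrow> h < e \<Longrightarrow> f (0 + h) < f 0"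
    using DERIV_neg_dec_right[OF assms(2,3)] by blast
  from this(2)[of "e / 2"] have "f (e / 2) < f 0" "0 < e / 2"
    using \<open>0 < e\<close> by auto
  then show ?thesis
    using homeomorphism_monotone[OF assms(1)] strict_monoD[of f 0 "e / 2"]
    by auto
qed

lemma quotient_tendsto_abs_deriv:
  fixes f :: "real \<Rightarrow> real"
  assumes "(f has_real_derivative D) (at 0)" "f 0 = 0"
  shows "((\<lambda>x. \<bar>f x / x\<bar>) \<longlongrightarrow> \<bar>D\<bar>) (at 0)"
  using assms by (intro tendsto_rabs) (simp add: has_field_derivative_iff)

lemma eventually_contraction:
  fixes f :: "real \<Rightarrow> real"
  assumes "(f has_real_derivative D) (at 0)" "f 0 = 0" "\<bar>D\<bar> < 1"
  shows "\<forall>\<^sub>F x in at 0. \<bar>f x\<bar> < \<bar>x\<bar>"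
proof -
  have "\<forall>\<^sub>F x in at 0. \<bar>f x / x\<bar> < 1"
    using order_tendstoD(2)[OF quotient_tendsto_abs_deriv[OF assms(1,2)] assms(3)] .
  moreover have "\<forall>\<^sub>F x::real in at 0. x \<noteq> 0"
    by (rule eventually_neq_at_within)
  ultimately show ?thesis
    by eventually_elim (simp add: divide_simps)
qed

text \<open>Here \<open>f'\<close> is the inverse, not the derivative. The inequality
  \<open>\<bar>x\<bar> < \<bar>f x\<bar>\<close> near 0 is read at \<open>x = f' y\<close>.\<close>

lemma eventually_inverse_contraction:
  fixes f :: "real \<Rightarrow> real"
  assumes "homeomorphism UNIV UNIV f f'" "(f has_real_derivative D) (at 0)" "f 0 = 0" "1 < \<bar>D\<bar>"
  shows "\<forall>\<^sub>F y in at 0. \<bar>f' y\<bar> < \<bar>y\<bar>"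
proof -
  have inv: "f' (f x) = x" "f (f' y) = y" for x y
    using assms(1) by (auto simp: homeomorphism_def)
  have "\<forall>\<^sub>F x in at 0. 1 < \<bar>f x / x\<bar>"
    using order_tendstoD(1)[OF quotient_tendsto_abs_deriv[OF assms(2,3)] assms(4)] .
  moreover have "\<forall>\<^sub>F x::real in at 0. x \<noteq> 0"
    by (rule eventually_neq_at_within)
  ultimately have ev: "\<forall>\<^sub>F x in at 0. \<bar>x\<bar> < \<bar>f x\<bar>"
    by eventually_elim (simp add: divide_simps split: if_splits)
  \<comment> \<open>The expansion is known on a punctured neighbourhood, so \<open>f' y\<close> must
    tend to 0 while staying different from 0.\<close>
  have "filterlim f' (at 0) (at 0)"
  proof (rule filterlim_atI)
    have "isCont f' 0"
      using assms(1) by (simp add: homeomorphism_def continuous_on_eq_continuous_at)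
    moreover have "f' 0 = 0"
      using inv(1)[of 0] assms(3) by simp
    ultimately show "(f' \<longlongrightarrow> 0) (at 0)"
      by (simp add: isCont_def)
    show "\<forall>\<^sub>F y in at 0. f' y \<noteq> 0"
      using eventually_neq_at_within[of 0 0 UNIV]
      by eventually_elim (use inv(2) assms(3) in metis)
  qed
  from eventually_compose_filterlim[OF ev this] show ?thesis
    by (simp add: inv)
qed

section \<open>A neighbourhood uniform in the sequence and its length, and the conjugacy
  theorem\<close>

text \<open>Finiteness of the index set allows one radius for all indices.\<close>

lemma eventually_at_0_cball:
  assumes "finite \<Lambda>" "\<And>l. l \<in> \<Lambda> \<Longrightarrow> \<forall>\<^sub>F x in at (0::real). P l x"
  obtains d where "0 < d" "\<And>l x. l \<in> \<Lambda> \<Longrightarrow> x \<noteq> 0 \<Longrightarrow> \<bar>x\<bar> \<le> d \<Longrightarrow> P l x"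
proof -
  have "\<forall>\<^sub>F x in at 0. \<forall>l\<in>\<Lambda>. P l x"
    using assms by (simp add: eventually_ball_finite)
  then obtain d where "0 < d" "\<And>x. x \<noteq> 0 \<Longrightarrow> \<bar>x\<bar> \<le> d \<Longrightarrow> \<forall>l\<in>\<Lambda>. P l x"
    by (auto simp: eventually_at_le dist_real_def)
  then show thesis
    by (intro that[of d]) auto
qed

text \<open>Take \<open>U = ball 0 d\<close> and let \<open>V\<close> be its image under
  \<open>h\<close>, open since \<open>h\<close> is a homeomorphism of the line. Of the two bounds in
  the premise, contractions use the one on \<open>x\<close>, expansions the one on the
  value.\<close>

lemma weakly_topologically_conjugate_near_0I:
  fixes f g :: "'i \<Rightarrow> real \<Rightarrow> real"
  assumes "0 < d"
    and "\<And>\<sigma> n. \<sigma> \<in> {1..} \<rightarrow> \<Lambda> \<Longrightarrow> 1 \<le> n \<Longrightarrow>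
      \<exists>h. strict_mono h \<and> surj h \<and> h 0 = 0 \<and>
        (\<forall>x. \<bar>x\<bar> \<le> d \<longrightarrow> \<bar>ifs_comp f \<sigma> n x\<bar> \<le> d \<longrightarrow> h (ifs_comp f \<sigma> n x) = ifs_comp g \<sigma> n (h x))"
  shows "weakly_topologically_conjugate_near_0 \<Lambda> f g"
  unfolding weakly_topologically_conjugate_near_0_def
proof (rule exI[of _ "ball 0 d"], intro conjI ballI allI impI)
  fix \<sigma> :: "nat \<Rightarrow> 'i" and n :: nat
  assume "\<sigma> \<in> {1..} \<rightarrow> \<Lambda>" "1 \<le> n"
  then obtain h where h: "strict_mono h" "surj h" "h 0 = 0"
    and conj: "\<And>x. \<bar>x\<bar> \<le> d \<Longrightarrow> \<bar>ifs_comp f \<sigma> n x\<bar> \<le> d \<Longrightarrow> h (ifs_comp f \<sigma> n x) = ifs_comp g \<sigma> n (h x)"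
    using assms(2) by blast
  have hom: "homeomorphism UNIV UNIV h (inv h)"
    using strict_mono_surj_homeomorphism[OF h(1,2)] .
  have "open (h ` ball 0 d)"
    using homeomorphism_imp_open_map[OF hom, of "ball 0 d"] by simp
  moreover have "0 \<in> h ` ball 0 d"
    using h(3) \<open>0 < d\<close> by force
  moreover have "homeomorphism (ball 0 d) (h ` ball 0 d) h (inv h)"
    by (rule homeomorphism_of_subsets[OF hom]) auto
  moreover have "\<forall>x\<in>ball 0 d. ifs_comp f \<sigma> n x \<in> ball 0 d \<longrightarrow>
      h (ifs_comp f \<sigma> n x) = ifs_comp g \<sigma> n (h x)"
    using conj by (simp add: dist_real_def)
  ultimately show "\<exists>V h h'. open V \<and> 0 \<in> V \<and> homeomorphism (ball 0 d) V h h' \<and>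
      (\<forall>x\<in>ball 0 d. ifs_comp f \<sigma> n x \<in> ball 0 d \<longrightarrow>
        h (ifs_comp f \<sigma> n x) = ifs_comp g \<sigma> n (h x))"
    by blast
qed (use \<open>0 < d\<close> in auto)

theorem theorem12:
  fixes \<Lambda> :: "'i set" and f g :: "'i \<Rightarrow> real \<Rightarrow> real"
  assumes "iterated_function_system \<Lambda> f" and "iterated_function_system \<Lambda> g"
    and "\<And>l. l \<in> \<Lambda> \<Longrightarrow> \<exists>f'. homeomorphism UNIV UNIV (f l) f'"
    and "\<And>l. l \<in> \<Lambda> \<Longrightarrow> \<exists>g'. homeomorphism UNIV UNIV (g l) g'"
    and "\<And>l. l \<in> \<Lambda> \<Longrightarrow> f l differentiable (at 0)"
    and "\<And>l. l \<in> \<Lambda> \<Longrightarrow> g l differentiable (at 0)"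
    and "\<And>l. l \<in> \<Lambda> \<Longrightarrow> f l 0 = 0"
    and "\<And>l. l \<in> \<Lambda> \<Longrightarrow> g l 0 = 0"
    and "\<exists>I \<in> {{0<..<1}, {-1<..<0}, {1<..}, {..<-1}}.
           \<forall>l\<in>\<Lambda>. deriv (f l) 0 \<in> I \<and> deriv (g l) 0 \<in> I"
  shows "weakly_topologically_conjugate_near_0 \<Lambda> f g"
proof -
  note f0 = assms(7) and g0 = assms(8)
  obtain I where I: "I \<in> {{0<..<1}, {-1<..<0}, {1<..}, {..<-1::real}}"
    and in_I: "\<And>l. l \<in> \<Lambda> \<Longrightarrow> deriv (f l) 0 \<in> I" "\<And>l. l \<in> \<Lambda> \<Longrightarrow> deriv (g l) 0 \<in> I"
    using assms(9) by blast
  have fin: "finite \<Lambda>"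
    using assms(1) by (simp add: iterated_function_system_def)
  obtain f' g' where hom: "\<And>l. l \<in> \<Lambda> \<Longrightarrow> homeomorphism UNIV UNIV (f l) (f' l)"
      "\<And>l. l \<in> \<Lambda> \<Longrightarrow> homeomorphism UNIV UNIV (g l) (g' l)"
    using assms(3,4) by metis
  have surj: "\<And>l. l \<in> \<Lambda> \<Longrightarrow> surj (f l)" "\<And>l. l \<in> \<Lambda> \<Longrightarrow> surj (g l)"
    using hom by (auto simp: homeomorphism_def)
  have der: "\<And>l. l \<in> \<Lambda> \<Longrightarrow> (f l has_real_derivative deriv (f l) 0) (at 0)"
      "\<And>l. l \<in> \<Lambda> \<Longrightarrow> (g l has_real_derivative deriv (g l) 0) (at 0)"
    using assms(5,6) by (metis DERIV_imp_deriv real_differentiable_def)+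
  \<comment> \<open>Each of the four intervals lies on one side of 0, so all maps of both systems
    share one direction.\<close>
  have dir: "(\<forall>l\<in>\<Lambda>. strict_mono (f l) \<and> strict_mono (g l)) \<or>
      (\<forall>l\<in>\<Lambda>. strict_antimono_on UNIV (f l) \<and> strict_antimono_on UNIV (g l))"
  proof -
    have "(\<forall>x\<in>I. 0 < x) \<or> (\<forall>x\<in>I. x < 0)"
      using I by auto
    then show ?thesis
      using in_I strict_mono_of_deriv_pos[OF hom(1) der(1)] strict_mono_of_deriv_pos[OF hom(2) der(2)]
        strict_antimono_of_deriv_neg[OF hom(1) der(1)] strict_antimono_of_deriv_neg[OF hom(2) der(2)]
      by blast
  qed
  have "(\<forall>x\<in>I. \<bar>x\<bar> < 1) \<or> (\<forall>x\<in>I. 1 < \<bar>x\<bar>)"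
    using I by auto
  then show ?thesis
  proof
    assume "\<forall>x\<in>I. \<bar>x\<bar> < 1"
    with in_I have "\<forall>\<^sub>F x in at 0. \<bar>f l x\<bar> < \<bar>x\<bar> \<and> \<bar>g l x\<bar> < \<bar>x\<bar>" if "l \<in> \<Lambda>" for l
      using that eventually_contraction[OF der(1) f0] eventually_contraction[OF der(2) g0]
      by (intro eventually_conj) auto
    \<comment> \<open>This \<open>d\<close> is fixed before \<open>\<sigma>\<close> and
      \<open>n\<close>, which makes the neighbourhood uniform.\<close>
    then obtain d where d: "0 < d"
      and c: "\<And>l x. l \<in> \<Lambda> \<Longrightarrow> x \<noteq> 0 \<Longrightarrow> \<bar>x\<bar> \<le> d \<Longrightarrow> \<bar>f l x\<bar> < \<bar>x\<bar> \<and> \<bar>g l x\<bar> < \<bar>x\<bar>"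
      using eventually_at_0_cball[OF fin, of "\<lambda>l x. \<bar>f l x\<bar> < \<bar>x\<bar> \<and> \<bar>g l x\<bar> < \<bar>x\<bar>"] by blast
    show ?thesis
    proof (rule weakly_topologically_conjugate_near_0I[OF d])
      fix \<sigma> :: "nat \<Rightarrow> 'i" and n :: nat
      assume \<sigma>: "\<sigma> \<in> {1..} \<rightarrow> \<Lambda>" and n: "1 \<le> n"
      obtain h where "strict_mono h" "surj h" "h 0 = 0"
          "\<And>x. \<bar>x\<bar> \<le> d \<Longrightarrow> h (ifs_comp f \<sigma> n x) = ifs_comp g \<sigma> n (h x)"
      proof (rule contraction_conjugacy[of "ifs_comp f \<sigma> n" "ifs_comp g \<sigma> n" d])
        show "\<bar>ifs_comp f \<sigma> n x\<bar> < \<bar>x\<bar>" "\<bar>ifs_comp g \<sigma> n x\<bar> < \<bar>x\<bar>" if "x \<noteq> 0" "\<bar>x\<bar> \<le> d" for x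
          using ifs_comp_contraction[where \<Lambda> = \<Lambda> and f = f and d = d, OF _ f0 \<sigma> n that]
            ifs_comp_contraction[where \<Lambda> = \<Lambda> and f = g and d = d, OF _ g0 \<sigma> n that] c
          by blast+
      qed (use same_direction_ifs_comp[OF dir \<sigma>] surj_ifs_comp[where \<Lambda> = \<Lambda> and f = f, OF surj(1) \<sigma>]
          surj_ifs_comp[where \<Lambda> = \<Lambda> and f = g, OF surj(2) \<sigma>] ifs_comp_fixed[where \<Lambda> = \<Lambda> and f = f, OF f0 \<sigma>] ifs_comp_fixed[where \<Lambda> = \<Lambda> and f = g, OF g0 \<sigma>] d in auto)
      then show "\<exists>h. strict_mono h \<and> surj h \<and> h 0 = 0 \<and> (\<forall>x. \<bar>x\<bar> \<le> d \<longrightarrow>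
          \<bar>ifs_comp f \<sigma> n x\<bar> \<le> d \<longrightarrow> h (ifs_comp f \<sigma> n x) = ifs_comp g \<sigma> n (h x))"
        by blast
    qed
  next
    assume "\<forall>x\<in>I. 1 < \<bar>x\<bar>"
    with in_I have "\<forall>\<^sub>F y in at 0. \<bar>f' l y\<bar> < \<bar>y\<bar> \<and> \<bar>g' l y\<bar> < \<bar>y\<bar>" if "l \<in> \<Lambda>" for l
      using that eventually_inverse_contraction[OF hom(1) der(1) f0] eventually_inverse_contraction[OF hom(2) der(2) g0]
      by (intro eventually_conj) auto
    then obtain d where d: "0 < d"
      and c': "\<And>l y. l \<in> \<Lambda> \<Longrightarrow> y \<noteq> 0 \<Longrightarrow> \<bar>y\<bar> \<le> d \<Longrightarrow> \<bar>f' l y\<bar> < \<bar>y\<bar> \<and> \<bar>g' l y\<bar> < \<bar>y\<bar>"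
      using eventually_at_0_cball[OF fin, of "\<lambda>l y. \<bar>f' l y\<bar> < \<bar>y\<bar> \<and> \<bar>g' l y\<bar> < \<bar>y\<bar>"] by blast
    have inv: "f' l (f l x) = x" "g' l (g l x) = x" if "l \<in> \<Lambda>" for l x
      using hom[OF that] by (auto simp: homeomorphism_def)
    \<comment> \<open>The contraction bound for the inverses at \<open>y = f l x\<close> and
      \<open>y = g l x\<close>; these are nonzero because \<open>x\<close> is. The bound now
      restricts values, as \<open>ifs_comp_expansion\<close> requires.\<close>
    have c: "\<bar>f l x\<bar> \<le> d \<Longrightarrow> \<bar>x\<bar> < \<bar>f l x\<bar>" "\<bar>g l x\<bar> \<le> d \<Longrightarrow> \<bar>x\<bar> < \<bar>g l x\<bar>"
      if "l \<in> \<Lambda>" "x \<noteq> 0" for l x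
      using c'[OF that(1), of "f l x"] c'[OF that(1), of "g l x"] inv[OF that(1)] f0 g0 that
      by metis+
    show ?thesis
    proof (rule weakly_topologically_conjugate_near_0I[OF d])
      fix \<sigma> :: "nat \<Rightarrow> 'i" and n :: nat
      assume \<sigma>: "\<sigma> \<in> {1..} \<rightarrow> \<Lambda>" and n: "1 \<le> n"
      obtain h where "strict_mono h" "surj h" "h 0 = 0"
          "\<And>x. \<bar>ifs_comp f \<sigma> n x\<bar> \<le> d \<Longrightarrow> h (ifs_comp f \<sigma> n x) = ifs_comp g \<sigma> n (h x)"
      proof (rule expansion_conjugacy[of "ifs_comp f \<sigma> n" "ifs_comp g \<sigma> n" d])
        show "\<bar>ifs_comp f \<sigma> n x\<bar> \<le> d \<Longrightarrow> \<bar>x\<bar> < \<bar>ifs_comp f \<sigma> n x\<bar>"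
          "\<bar>ifs_comp g \<sigma> n x\<bar> \<le> d \<Longrightarrow> \<bar>x\<bar> < \<bar>ifs_comp g \<sigma> n x\<bar>" if "x \<noteq> 0" for x
          using ifs_comp_expansion[where \<Lambda> = \<Lambda> and f = f and d = d, OF _ f0 \<sigma> n that]
            ifs_comp_expansion[where \<Lambda> = \<Lambda> and f = g and d = d, OF _ g0 \<sigma> n that] c
          by blast+
      qed (use same_direction_ifs_comp[OF dir \<sigma>] surj_ifs_comp[where \<Lambda> = \<Lambda> and f = f, OF surj(1) \<sigma>]
          surj_ifs_comp[where \<Lambda> = \<Lambda> and f = g, OF surj(2) \<sigma>] ifs_comp_fixed[where \<Lambda> = \<Lambda> and f = f, OF f0 \<sigma>] ifs_comp_fixed[where \<Lambda> = \<Lambda> and f = g, OF g0 \<sigma>] d in auto)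
      then show "\<exists>h. strict_mono h \<and> surj h \<and> h 0 = 0 \<and> (\<forall>x. \<bar>x\<bar> \<le> d \<longrightarrow>
          \<bar>ifs_comp f \<sigma> n x\<bar> \<le> d \<longrightarrow> h (ifs_comp f \<sigma> n x) = ifs_comp g \<sigma> n (h x))"
        by blast
    qed
  qed
qed

end
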